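(* Let $(M_n)_{n\ge1}$, $M_n=(f_n(m,k))_{1\le m,k\le 2n}$, be the Delta sequence. Then each $M_n$ is symmetric with respect to its counter-diagonal: $$f_n(m,k)=f_n(2n+1-k,\,2n+1-m)\qquad(1\le m,k\le 2n).$$
   Context: Delta sequence. For $n\ge1$, $M_n=(f_n(m,k))_{1\le m,k\le 2n}$ is a $2n\times 2n$ matrix; by convention $f_n(m,k)=0$ if $(m,k)\notin[1,2n]^2$. Write $f_n(m,\bullet)=\sum_{k=1}^{2n}f_n(m,k)$ and $f_n(\bullet,k)=\sum_{m=1}^{2n}f_n(m,k)$. Let $L_n^{(1)}=\{(m,k):2\le k+1\le m\le 2n-2\}$ and $U_n^{(1)}=\{(m,k):2\le m+1\le k\le 2n-2\}$. The Delta sequence is the unique sequence $(M_n)_{n\ge1}$ of matrices with nonnegative integer entries such that $M_1=\begin{pmatrix}0&0\\1&0\end{pmatrix}$ and, for every $n\ge2$: (a) $f_n(m,m)=0$ for all $m$; (b) $f_n(m+2,k)-2f_n(m+1,k)+f_n(m,k)+2f_{n-1}(m,k)=0$ for $(m,k)\in L_n^{(1)}$; (c) $f_n(m,k+2)-2f_n(m,k+1)+f_n(m,k)+2f_{n-1}(m,k)=0$ for $(m,k)\in U_n^{(1)}$; (d) column $2n$ of $M_n$ is zero, and column $2n-1$ is $(f_{n-1}(1,\bullet),\dots,f_{n-1}(2n-2,\bullet),0,0)$ read top to bottom; (e) row $2n$ of $M_n$ is $(f_{n-1}(1,\bullet),\dots,f_{n-1}(2n-2,\bullet),0,0)$ read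 left to right, and row $2n-1$ is $(f_{n-1}(1,\bullet)+f_{n-1}(\bullet,1),\dots,f_{n-1}(2n-2,\bullet)+f_{n-1}(\bullet,2n-2),0,0)$. (These conditions determine the sequence uniquely.) *)

theory Defs
  imports Main
begin

text \<open>
  A sequence of matrices is a function \<open>f\<close> with \<open>f n m k\<close> the entry in row \<open>m\<close> and column \<open>k\<close>
  of the \<open>2n \<times> 2n\<close> matrix \<open>M\<^sub>n\<close>; rows and columns are numbered from 1. The value \<open>f 0\<close> is
  irrelevant, since the sequence starts at \<open>n = 1\<close>.
\<close>

definition row_sum :: "(nat \<Rightarrow> nat \<Rightarrow> nat \<Rightarrow> int) \<Rightarrow> nat \<Rightarrow> nat \<Rightarrow> int" where
  "row_sum f n m = (\<Sum>k = 1..2 * n. f n m k)"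

definition col_sum :: "(nat \<Rightarrow> nat \<Rightarrow> nat \<Rightarrow> int) \<Rightarrow> nat \<Rightarrow> nat \<Rightarrow> int" where
  "col_sum f n k = (\<Sum>m = 1..2 * n. f n m k)"

definition L1 :: "nat \<Rightarrow> (nat \<times> nat) set" where
  "L1 n = {(m, k). 2 \<le> k + 1 \<and> k + 1 \<le> m \<and> m \<le> 2 * n - 2}"

definition U1 :: "nat \<Rightarrow> (nat \<times> nat) set" where
  "U1 n = {(m, k). 2 \<le> m + 1 \<and> m + 1 \<le> k \<and> k \<le> 2 * n - 2}"

definition delta_sequence :: "(nat \<Rightarrow> nat \<Rightarrow> nat \<Rightarrow> int) \<Rightarrow> bool" where
  "delta_sequence f \<longleftrightarrow>
     (\<forall>n\<ge>1. \<forall>m k. f n m k \<ge> 0) \<and>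
     (\<forall>n\<ge>1. \<forall>m k. \<not> (m \<in> {1..2 * n} \<and> k \<in> {1..2 * n}) \<longrightarrow> f n m k = 0) \<and>
     f 1 1 1 = 0 \<and> f 1 1 2 = 0 \<and> f 1 2 1 = 1 \<and> f 1 2 2 = 0 \<and>
     (\<forall>n\<ge>2.
        (\<forall>m\<in>{1..2 * n}. f n m m = 0) \<and>
        (\<forall>(m, k)\<in>L1 n. f n (m + 2) k - 2 * f n (m + 1) k + f n m k + 2 * f (n - 1) m k = 0) \<and>
        (\<forall>(m, k)\<in>U1 n. f n m (k + 2) - 2 * f n m (k + 1) + f n m k + 2 * f (n - 1) m k = 0) \<and>
        (\<forall>m\<in>{1..2 * n}. f n m (2 * n) = 0) \<and>
        (\<forall>m\<in>{1..2 * n - 2}. f n m (2 * n - 1) = row_sum f (n - 1) m) \<and>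
        f n (2 * n - 1) (2 * n - 1) = 0 \<and> f n (2 * n) (2 * n - 1) = 0 \<and>
        (\<forall>k\<in>{1..2 * n - 2}. f n (2 * n) k = row_sum f (n - 1) k) \<and>
        f n (2 * n) (2 * n - 1) = 0 \<and> f n (2 * n) (2 * n) = 0 \<and>
        (\<forall>k\<in>{1..2 * n - 2}. f n (2 * n - 1) k = row_sum f (n - 1) k + col_sum f (n - 1) k) \<and>
        f n (2 * n - 1) (2 * n - 1) = 0 \<and> f n (2 * n - 1) (2 * n) = 0)"

end

theory Submission
  imports Defs
begin

text \<open>
  Write \<open>r\<^sub>n(j)\<close> for the \<open>j\<close>-th row sum of \<open>M\<^sub>n\<close>. The counter-diagonal symmetry is proved by induction
  on \<open>n\<close>, simultaneously with the following properties:
  \<^item> the two triangles differ by row sums: \<open>f\<^sub>n(k + d, k) = f\<^sub>n(k, k + d) + r\<^bsub>n-1\<^esub>(d)\<close> for \<open>d \<ge> 1\<close>;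
  \<^item> \<open>r\<^sub>n\<close> satisfies \<open>\<Delta>\<^sup>2 r\<^sub>n(j) = -2 r\<^bsub>n-1\<^esub>(j)\<close>, vanishes at 1 and is palindromic:
    \<open>r\<^sub>n(j) = r\<^sub>n(2n + 2 - j)\<close>;
  \<^item> the lower triangle satisfies the reflected recurrence, in which the second difference
    is taken along rows.

  In each case both sides satisfy the same second-order difference equation, so it suffices to
  compare two consecutive values on the boundary. The recurrence for \<open>r\<^sub>n\<close> is obtained by summing
  the recurrences of the entries over a row; the terms next to the diagonal that these do not cover
  cancel, because \<open>2 f\<^sub>n(m + 2, m) - f\<^sub>n(m + 1, m) - f\<^sub>n(m + 2, m + 1)\<close> does not depend on \<open>m\<close>.
\<close>

section \<open>Second-order difference equations and splitting of sums\<close>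

text \<open>Runs downwards because the last rows and columns carry the boundary data. The second
  boundary value is guarded, since near the corner the interval shrinks to a single point.\<close>

lemma second_difference_unique_down:
  fixes u v :: "nat \<Rightarrow> int"
  assumes "\<And>m. \<lbrakk>a \<le> m; m + 2 \<le> b\<rbrakk> \<Longrightarrow>
      u (m + 2) - 2 * u (m + 1) + u m = v (m + 2) - 2 * v (m + 1) + v m"
    and "u b = v b" and "a < b \<Longrightarrow> u (b - 1) = v (b - 1)"
    and "a \<le> m" and "m \<le> b"
  shows "u m = v m"
  using assms(4,5)
proof (induction "b - m" arbitrary: m rule: less_induct)
  case less
  consider "m = b" | "m + 1 = b" | "m + 2 \<le> b" using less.prems by linarith
  then show ?case
  proof cases
    case 1 then show ?thesis using assms(2) by simp
  next
    case 2 then show ?thesis using assms(3) less.prems by auto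
  next
    case 3
    have "u (m + 1) = v (m + 1)" "u (m + 2) = v (m + 2)"
      using less 3 by auto
    with assms(1)[of m] less.prems 3 show ?thesis by linarith
  qed
qed

lemma second_difference_unique_up:
  fixes u v :: "nat \<Rightarrow> int"
  assumes "\<And>m. \<lbrakk>a \<le> m; m + 2 \<le> b\<rbrakk> \<Longrightarrow>
      u (m + 2) - 2 * u (m + 1) + u m = v (m + 2) - 2 * v (m + 1) + v m"
    and "u a = v a" and "u (a + 1) = v (a + 1)"
    and "a \<le> m" and "m \<le> b"
  shows "u m = v m"
  using assms(4,5)
proof (induction m rule: less_induct)
  case (less m)
  consider "m = a" | "m = a + 1" | "a + 2 \<le> m" using less.prems by linarith
  then show ?case
  proof cases
    case 3
    then obtain i where i: "m = i + 2" "a \<le> i"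
      by (metis add.commute add_le_cancel_right le_Suc_ex le_add2 le_trans)
    have "u (i + 1) = v (i + 1)" "u i = v i"
      using less i by auto
    with assms(1)[of i] less.prems i show ?thesis by simp
  qed (use assms(2,3) in auto)
qed

lemma sum_reflect_from_1:
  fixes g :: "nat \<Rightarrow> int"
  shows "(\<Sum>k = 1..N. g (N + 1 - k)) = (\<Sum>k = 1..N. g k)"
  by (rule sum.reindex_bij_witness[of _ "\<lambda>k. N + 1 - k" "\<lambda>k. N + 1 - k"]) auto

lemma sum_split_1:
  fixes g :: "nat \<Rightarrow> int"
  assumes "1 \<le> j" "j \<le> N"
  shows "(\<Sum>k = 1..N. g k) = (\<Sum>k = 1..<j. g k) + g j + (\<Sum>k = j + 1..N. g k)"
  using assms(2)
proof (induction N rule: dec_induct)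
  case base
  have "{1..j} = insert j {1..<j}" using assms by auto
  then show ?case by simp
qed (use assms in simp)

text \<open>Prepares the summation over a row: the middle block holds the three entries around the
  diagonal, and the shift by two aligns the columns of consecutive matrices to its right.\<close>

lemma sum_split_3:
  fixes g :: "nat \<Rightarrow> int"
  assumes "1 \<le> j" "j \<le> N"
  shows "(\<Sum>k = 1..N + 2. g k)
    = (\<Sum>k = 1..<j. g k) + (g j + g (j + 1) + g (j + 2)) + (\<Sum>k = j + 1..N. g (k + 2))"
  using assms(2)
proof (induction N rule: dec_induct)
  case base
  show ?case using sum_split_1[OF assms(1) order_refl, of g] by simp
qed simp

section \<open>The defining conditions of the Delta sequence\<close>

locale delta =
  fixes f :: "nat \<Rightarrow> nat \<Rightarrow> nat \<Rightarrow> int"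
  assumes delta: "delta_sequence f"
begin

text \<open>The value at \<open>n = 0\<close> is the one that makes the recurrences below start already at \<open>n = 1\<close>.\<close>

definition r :: "nat \<Rightarrow> nat \<Rightarrow> int" where
  "r n j = (if n = 0 then of_bool (j = 1) else row_sum f n j)"

lemma zero_outside: "1 \<le> n \<Longrightarrow> \<not> (m \<in> {1..2 * n} \<and> k \<in> {1..2 * n}) \<Longrightarrow> f n m k = 0"
  using delta unfolding delta_sequence_def by blast

lemma base: "f 1 1 1 = 0" "f 1 1 2 = 0" "f 1 2 1 = 1" "f 1 2 2 = 0"
  using delta unfolding delta_sequence_def by blast+

lemmas base' = base[unfolded One_nat_def]

lemma step:
  assumes "1 \<le> n"
  shows "\<lbrakk>1 \<le> m; m \<le> 2 * n + 2\<rbrakk> \<Longrightarrow> f (Suc n) m m = 0"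
    and "\<lbrakk>1 \<le> k; k < m; m \<le> 2 * n\<rbrakk> \<Longrightarrow>
      f (Suc n) (m + 2) k - 2 * f (Suc n) (m + 1) k + f (Suc n) m k = - 2 * f n m k"
    and "\<lbrakk>1 \<le> m; m < k; k \<le> 2 * n\<rbrakk> \<Longrightarrow>
      f (Suc n) m (k + 2) - 2 * f (Suc n) m (k + 1) + f (Suc n) m k = - 2 * f n m k"
    and "f (Suc n) m (2 * n + 2) = 0"
    and "\<lbrakk>1 \<le> m; m \<le> 2 * n\<rbrakk> \<Longrightarrow> f (Suc n) m (2 * n + 1) = r n m"
    and "f (Suc n) (2 * n + 2) (2 * n + 1) = 0"
    and "\<lbrakk>1 \<le> k; k \<le> 2 * n\<rbrakk> \<Longrightarrow> f (Suc n) (2 * n + 2) k = r n k"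
    and "\<lbrakk>1 \<le> k; k \<le> 2 * n\<rbrakk> \<Longrightarrow> f (Suc n) (2 * n + 1) k = r n k + col_sum f n k"
proof -
  have "Suc n \<ge> 2" using assms by simp
  then have *: "(\<forall>m\<in>{1..2 * Suc n}. f (Suc n) m m = 0) \<and>
        (\<forall>(m, k)\<in>L1 (Suc n). f (Suc n) (m + 2) k - 2 * f (Suc n) (m + 1) k + f (Suc n) m k + 2 * f (Suc n - 1) m k = 0) \<and>
        (\<forall>(m, k)\<in>U1 (Suc n). f (Suc n) m (k + 2) - 2 * f (Suc n) m (k + 1) + f (Suc n) m k + 2 * f (Suc n - 1) m k = 0) \<and>
        (\<forall>m\<in>{1..2 * Suc n}. f (Suc n) m (2 * Suc n) = 0) \<and>
        (\<forall>m\<in>{1..2 * Suc n - 2}. f (Suc n) m (2 * Suc n - 1) = row_sum f (Suc n - 1) m) \<and>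
        f (Suc n) (2 * Suc n) (2 * Suc n - 1) = 0 \<and>
        (\<forall>k\<in>{1..2 * Suc n - 2}. f (Suc n) (2 * Suc n) k = row_sum f (Suc n - 1) k) \<and>
        (\<forall>k\<in>{1..2 * Suc n - 2}. f (Suc n) (2 * Suc n - 1) k = row_sum f (Suc n - 1) k + col_sum f (Suc n - 1) k)"
    using delta unfolding delta_sequence_def by blast
  have r: "r n j = row_sum f n j" for j using assms by (simp add: r_def)
  show "f (Suc n) m m = 0" if "1 \<le> m" "m \<le> 2 * n + 2" using * that by auto
  show "f (Suc n) (m + 2) k - 2 * f (Suc n) (m + 1) k + f (Suc n) m k = - 2 * f n m k"
    if "1 \<le> k" "k < m" "m \<le> 2 * n"
  proof -
    have "(m, k) \<in> L1 (Suc n)" using that by (auto simp: L1_def)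
    with * show ?thesis by fastforce
  qed
  show "f (Suc n) m (k + 2) - 2 * f (Suc n) m (k + 1) + f (Suc n) m k = - 2 * f n m k"
    if "1 \<le> m" "m < k" "k \<le> 2 * n"
  proof -
    have "(m, k) \<in> U1 (Suc n)" using that by (auto simp: U1_def)
    with * show ?thesis by fastforce
  qed
  show "f (Suc n) m (2 * n + 2) = 0"
    using * zero_outside[of "Suc n" m "2 * n + 2"] by (cases "m \<in> {1..2 * Suc n}") auto
  show "f (Suc n) m (2 * n + 1) = r n m" if "1 \<le> m" "m \<le> 2 * n" using * that r by auto
  show "f (Suc n) (2 * n + 2) (2 * n + 1) = 0" using * by auto
  show "f (Suc n) (2 * n + 2) k = r n k" if "1 \<le> k" "k \<le> 2 * n" using * that r by auto
  show "f (Suc n) (2 * n + 1) k = r n k + col_sum f n k" if "1 \<le> k" "k \<le> 2 * n"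
    using * that r by auto
qed

lemma r_outside: "1 \<le> n \<Longrightarrow> \<not> (1 \<le> j \<and> j \<le> 2 * n) \<Longrightarrow> r n j = 0"
  by (simp add: r_def row_sum_def zero_outside)

lemma diagonal: "1 \<le> n \<Longrightarrow> f n m m = 0"
proof (cases n)
  case (Suc n')
  assume n: "1 \<le> n"
  show ?thesis
  proof (cases "m \<in> {1..2 * n}")
    case False then show ?thesis using zero_outside n by blast
  next
    case True
    show ?thesis
    proof (cases "n' = 0")
      case True
      with Suc \<open>m \<in> {1..2 * n}\<close> have "m = 1 \<or> m = 2" by auto
      with True Suc show ?thesis using base' by auto
    next
      case False
      with True Suc step(1)[of n' m] show ?thesis by auto
    qed
  qed
qed simp

text \<open>The condition on the last row extends to \<open>n = 0\<close> by the convention for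
  \<open>r 0\<close>, and to the last two columns because \<open>r n\<close> vanishes there.\<close>

lemma last_row: "1 \<le> k \<Longrightarrow> k \<le> 2 * n + 2 \<Longrightarrow> f (Suc n) (2 * n + 2) k = r n k"
proof (cases "n = 0")
  case True
  assume "1 \<le> k" "k \<le> 2 * n + 2"
  with True have "k = 1 \<or> k = 2" by auto
  then show ?thesis using True base' by (auto simp: r_def numeral_2_eq_2)
next
  case False
  assume k: "1 \<le> k" "k \<le> 2 * n + 2"
  consider "k \<le> 2 * n" | "k = 2 * n + 1" | "k = 2 * n + 2" using k by linarith
  then show ?thesis using step(4,6,7)[of n] False k r_outside[of n k] by cases auto
qed

end

section \<open>The induction hypothesis and its first consequences\<close>

text \<open>The induction hypothesis for a single \<open>n\<close>. Symmetry is stated below the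
  diagonal, as \<open>transpose\<close> carries it above; \<open>penultimate_row\<close> is
  condition (e) with the column sum already turned into a row sum.\<close>

locale delta_step = delta +
  fixes n :: nat
  assumes n: "1 \<le> n"
    and row_sum_rec: "\<lbrakk>1 \<le> j; j < 2 * n\<rbrakk> \<Longrightarrow>
      r n (j + 2) - 2 * r n (j + 1) + r n j = - 2 * r (n - 1) j"
    and row_sum_1: "r n 1 = 0"
    and row_sum_sym: "i + j = 2 * n + 2 \<Longrightarrow> r n i = r n j"
    and transpose: "\<lbrakk>1 \<le> k; 1 \<le> d; k + d \<le> 2 * n\<rbrakk> \<Longrightarrow>
      f n (k + d) k = f n k (k + d) + r (n - 1) d"
    and lower_sym: "\<lbrakk>1 \<le> k; k < m; m + k' = 2 * n + 1; k + m' = 2 * n + 1\<rbrakk> \<Longrightarrow>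
      f n m k = f n m' k'"
    and row_rec: "\<lbrakk>1 \<le> k; k < m; m + 2 \<le> 2 * n\<rbrakk> \<Longrightarrow>
      f n (m + 2) k - 2 * f n (m + 2) (k + 1) + f n (m + 2) (k + 2) = - 2 * f (n - 1) m k"
    and penultimate_row: "\<lbrakk>1 \<le> k; 1 \<le> j; k + j + 1 = 2 * n\<rbrakk> \<Longrightarrow>
      f n (2 * n - 1) k = r (n - 1) k + r (n - 1) j"
begin

text \<open>Reflection preserves the distance \<open>d\<close> from the diagonal, so
  \<open>transpose\<close> adds the same \<open>r (n - 1) d\<close> on both sides and the upper
  triangle follows from the lower one.\<close>

lemma counter_sym:
  assumes "1 \<le> k" "1 \<le> m" "m + k' = 2 * n + 1" "k + m' = 2 * n + 1"
  shows "f n m k = f n m' k'"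
proof -
  consider "k < m" | "k = m" | "m < k" "k \<le> 2 * n" | "k > 2 * n" by linarith
  then show ?thesis
  proof cases
    case 1 then show ?thesis using lower_sym assms by blast
  next
    case 2
    then have "m' = k'" using assms by simp
    then show ?thesis using diagonal n 2 by simp
  next
    case 3
    define d where "d = k - m"
    have d: "k = m + d" "1 \<le> d" using 3 by (auto simp: d_def)
    have k': "k' = m' + d" "1 \<le> m'" "k' \<le> 2 * n" using 3 d assms by auto
    have "f n k m = f n k' m'" using lower_sym[of m k m' k'] assms 3 by simp
    moreover have "f n k m = f n m k + r (n - 1) d" using transpose[of m d] d 3 assms by simp
    moreover have "f n k' m' = f n m' k' + r (n - 1) d" using transpose[of m' d] d k' by simp
    ultimately show ?thesis by simp
  next
    case 4
    then have "m' = 0" using assms by simp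
    with 4 show ?thesis using zero_outside n by auto
  qed
qed

lemma col_sum: "k + j = 2 * n + 1 \<Longrightarrow> 1 \<le> k \<Longrightarrow> col_sum f n k = r n j"
proof -
  assume k: "k + j = 2 * n + 1" "1 \<le> k"
  have "col_sum f n k = (\<Sum>m = 1..2 * n. f n j (2 * n + 1 - m))"
    unfolding col_sum_def using k by (intro sum.cong) (auto intro!: counter_sym)
  also have "\<dots> = row_sum f n j"
    unfolding row_sum_def by (rule sum_reflect_from_1)
  finally show ?thesis using n by (simp add: r_def)
qed

lemma bottom_row: "1 \<le> k \<Longrightarrow> k \<le> 2 * n \<Longrightarrow> f n (2 * n) k = r (n - 1) k"
  using last_row[of k "n - 1"] n by (cases n) auto

lemma prev_col_rec:
  assumes "1 \<le> k" "k < m" "m + 2 \<le> 2 * n"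
  shows "f n (m + 2) k - 2 * f n (m + 1) k + f n m k = - 2 * f (n - 1) m k"
  using step(2)[of "n - 1" k m] assms by auto

section \<open>Reflected recurrence and transposition at level \<open>Suc n\<close>\<close>

lemma Suc_penultimate_row:
  "\<lbrakk>1 \<le> k; 1 \<le> j; k + j = 2 * n + 1\<rbrakk> \<Longrightarrow> f (Suc n) (2 * n + 1) k = r n k + r n j"
  using step(8)[of n k] col_sum[of k j] n by auto

text \<open>As functions of \<open>m\<close>, both sides have second difference
  \<open>4 * f (n - 1) m k\<close>: the left by the column recurrence followed by
  \<open>row_rec\<close>, the right by \<open>prev_col_rec\<close>.\<close>

lemma Suc_row_rec:
  assumes "1 \<le> k" "k < m" "m \<le> 2 * n"
  shows "f (Suc n) (m + 2) k - 2 * f (Suc n) (m + 2) (k + 1) + f (Suc n) (m + 2) (k + 2)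
    = - 2 * f n m k"
proof (rule second_difference_unique_down[where a = "k + 1" and b = "2 * n" and m = m
      and v = "\<lambda>m. - 2 * f n m k" and u = "\<lambda>m. f (Suc n) (m + 2) k
      - 2 * f (Suc n) (m + 2) (k + 1) + f (Suc n) (m + 2) (k + 2)"])
  show "f (Suc n) (2 * n + 2) k - 2 * f (Suc n) (2 * n + 2) (k + 1)
      + f (Suc n) (2 * n + 2) (k + 2) = - 2 * f n (2 * n) k"
    using last_row[of k n] last_row[of "k + 1" n] last_row[of "k + 2" n]
      row_sum_rec[of k] bottom_row[of k] assms by auto
next
  assume "k + 1 < 2 * n"
  \<comment> \<open>Row \<open>2 * n + 1\<close> has entries \<open>r n k + r n (j + 2)\<close>,
    \<open>r n (k + 1) + r n (j + 1)\<close>, \<open>r n (k + 2) + r n j\<close>, so its second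
    difference splits into those of \<open>r n\<close> at \<open>k\<close> and at
    \<open>j\<close>.\<close>
  then obtain j where j: "k + j + 1 = 2 * n" "1 \<le> j"
    by (auto dest!: less_imp_Suc_add)
  have "2 * n - 1 + 2 = 2 * n + 1" using n by simp
  then show "f (Suc n) (2 * n - 1 + 2) k - 2 * f (Suc n) (2 * n - 1 + 2) (k + 1)
      + f (Suc n) (2 * n - 1 + 2) (k + 2) = - 2 * f n (2 * n - 1) k"
    using Suc_penultimate_row[of k "j + 2"] Suc_penultimate_row[of "k + 1" "j + 1"]
      Suc_penultimate_row[of "k + 2" j] row_sum_rec[of k] row_sum_rec[of j]
      penultimate_row[of k j] assms j by auto
next
  fix m assume m: "k + 1 \<le> m" "m + 2 \<le> 2 * n"
  show "f (Suc n) (m + 2 + 2) k - 2 * f (Suc n) (m + 2 + 2) (k + 1)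
        + f (Suc n) (m + 2 + 2) (k + 2)
      - 2 * (f (Suc n) (m + 1 + 2) k - 2 * f (Suc n) (m + 1 + 2) (k + 1)
        + f (Suc n) (m + 1 + 2) (k + 2))
      + (f (Suc n) (m + 2) k - 2 * f (Suc n) (m + 2) (k + 1) + f (Suc n) (m + 2) (k + 2))
    = - 2 * f n (m + 2) k - 2 * (- 2 * f n (m + 1) k) + - 2 * f n m k"
    using step(2)[of n k "m + 2"] step(2)[of n "k + 1" "m + 2"] step(2)[of n "k + 2" "m + 2"]
      row_rec[of k m] prev_col_rec[of k m] m assms n by (simp add: numeral_eq_Suc)
qed (use assms in auto)

text \<open>The second differences in \<open>d\<close> agree by \<open>transpose\<close> at level
  \<open>n\<close>. At the far end the last row \<open>r n k\<close> meets a zero column, which is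
  where the palindromicity of \<open>r n\<close> enters.\<close>

lemma Suc_transpose:
  assumes "1 \<le> k" "1 \<le> d" "k + d \<le> 2 * n + 2"
  shows "f (Suc n) (k + d) k = f (Suc n) k (k + d) + r n d"
proof (rule second_difference_unique_down[where a = 1 and b = "2 * n + 2 - k" and m = d
      and u = "\<lambda>d. f (Suc n) (k + d) k" and v = "\<lambda>d. f (Suc n) k (k + d) + r n d"])
  have k: "k + (2 * n + 2 - k) = 2 * n + 2" using assms by simp
  then show "f (Suc n) (k + (2 * n + 2 - k)) k
      = f (Suc n) k (k + (2 * n + 2 - k)) + r n (2 * n + 2 - k)"
    using last_row[of k n] step(4)[of n k] row_sum_sym[of k "2 * n + 2 - k"] n assms
    by (simp del: Nat.add_diff_assoc)
next
  assume *: "1 < 2 * n + 2 - k"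
  define j where "j = 2 * n + 1 - k"
  then have j: "k + j = 2 * n + 1" "1 \<le> j" "2 * n + 2 - k - 1 = j"
    using * by auto
  show "f (Suc n) (k + (2 * n + 2 - k - 1)) k
      = f (Suc n) k (k + (2 * n + 2 - k - 1)) + r n (2 * n + 2 - k - 1)"
    unfolding j(3) using Suc_penultimate_row[of k j] step(5)[of n k] n j assms by auto
next
  fix d assume d: "1 \<le> d" "d + 2 \<le> 2 * n + 2 - k"
  then have "k + d \<le> 2 * n" "d < 2 * n" using assms by auto
  with d show "f (Suc n) (k + (d + 2)) k - 2 * f (Suc n) (k + (d + 1)) k + f (Suc n) (k + d) k
    = f (Suc n) k (k + (d + 2)) + r n (d + 2) - 2 * (f (Suc n) k (k + (d + 1)) + r n (d + 1))
      + (f (Suc n) k (k + d) + r n d)"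
    using step(2)[of n k "k + d"] step(3)[of n k "k + d"] row_sum_rec[of d] transpose[of k d]
      assms n by (simp add: add.assoc)
qed (use assms in auto)

section \<open>Counter-diagonal symmetry at level \<open>Suc n\<close>\<close>

text \<open>The first two columns mirror the last two rows. At level \<open>n\<close> this follows
  from symmetry; at level \<open>Suc n\<close> it is derived first and then serves as boundary data
  for symmetry.\<close>

lemma column_1:
  assumes "2 \<le> m" "m + j = 2 * n + 1" "1 \<le> j"
  shows "f n m 1 = r (n - 1) j"
  using lower_sym[of 1 m j "2 * n"] bottom_row[of j] assms by auto

lemma column_2:
  assumes "3 \<le> m" "m + j = 2 * n + 1" "1 \<le> j"
  shows "f n m 2 = r (n - 1) j + r (n - 1) (m - 2)"
  using lower_sym[of 2 m j "2 * n - 1"] penultimate_row[of j "m - 2"] assms by auto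

lemma Suc_column_1:
  assumes "2 \<le> m" "m + j = 2 * n + 3" "1 \<le> j"
  shows "f (Suc n) m 1 = r n j"
proof -
  have "f (Suc n) m 1 = r n (2 * n + 3 - m)"
  proof (rule second_difference_unique_down[where a = 2 and b = "2 * n + 2" and m = m])
    show "f (Suc n) (2 * n + 2) 1 = r n (2 * n + 3 - (2 * n + 2))"
      using last_row[of 1 n] by simp
    \<comment> \<open>The entry is \<open>r n 1 + r n (2 * n)\<close>; the first term vanishes and
      the second equals \<open>r n 2\<close> by palindromicity.\<close>
    show "f (Suc n) (2 * n + 2 - 1) 1 = r n (2 * n + 3 - (2 * n + 2 - 1))"
      using Suc_penultimate_row[of 1 "2 * n"] row_sum_sym[of 2 "2 * n"] row_sum_1 n by simp
  next
    fix m assume m: "2 \<le> m" "m + 2 \<le> 2 * n + 2"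
    \<comment> \<open>The mirrored argument decreases as \<open>m\<close> grows; a second difference
      is unchanged by this reversal, so \<open>row_sum_rec\<close> applies at its lower end
      \<open>i\<close>.\<close>
    define i where "i = 2 * n + 1 - m"
    have i: "m + i = 2 * n + 1" "1 \<le> i" "2 * n + 3 - (m + 2) = i"
      "2 * n + 3 - (m + 1) = i + 1" "2 * n + 3 - m = i + 2"
      using m by (auto simp: i_def)
    show "f (Suc n) (m + 2) 1 - 2 * f (Suc n) (m + 1) 1 + f (Suc n) m 1
      = r n (2 * n + 3 - (m + 2)) - 2 * r n (2 * n + 3 - (m + 1)) + r n (2 * n + 3 - m)"
      unfolding i(3-5) using step(2)[of n 1 m] column_1[of m i] row_sum_rec[of i] m i n by auto
  qed (use assms in auto)
  moreover have "2 * n + 3 - m = j" using assms by simp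
  ultimately show ?thesis by simp
qed

lemma Suc_column_2:
  assumes "3 \<le> m" "m + j = 2 * n + 3" "1 \<le> j"
  shows "f (Suc n) m 2 = r n j + r n (m - 2)"
proof -
  have "f (Suc n) m 2 = r n (2 * n + 3 - m) + r n (m - 2)"
  proof (rule second_difference_unique_down[where a = 3 and b = "2 * n + 2" and m = m])
    show "f (Suc n) (2 * n + 2) 2 = r n (2 * n + 3 - (2 * n + 2)) + r n (2 * n + 2 - 2)"
      using last_row[of 2 n] row_sum_sym[of 2 "2 * n"] row_sum_1 n by simp
    show "f (Suc n) (2 * n + 2 - 1) 2
        = r n (2 * n + 3 - (2 * n + 2 - 1)) + r n (2 * n + 2 - 1 - 2)"
      using Suc_penultimate_row[of 2 "2 * n - 1"] n by simp
  next
    fix m assume m: "3 \<le> m" "m + 2 \<le> 2 * n + 2"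
    define i where "i = 2 * n + 1 - m"
    define l where "l = m - 2"
    have i: "m + i = 2 * n + 1" "1 \<le> i" "2 * n + 3 - (m + 2) = i"
      "2 * n + 3 - (m + 1) = i + 1" "2 * n + 3 - m = i + 2"
      using m by (auto simp: i_def)
    have l: "m = l + 2" "1 \<le> l" "m + 2 - 2 = l + 2" "m + 1 - 2 = l + 1" "m - 2 = l"
      using m by (auto simp: l_def)
    show "f (Suc n) (m + 2) 2 - 2 * f (Suc n) (m + 1) 2 + f (Suc n) m 2
      = r n (2 * n + 3 - (m + 2)) + r n (m + 2 - 2)
        - 2 * (r n (2 * n + 3 - (m + 1)) + r n (m + 1 - 2)) + (r n (2 * n + 3 - m) + r n (m - 2))"
      unfolding i(3-5) l(3-5)
      using step(2)[of n 2 m] column_2[of m i] row_sum_rec[of i] row_sum_rec[of l] m i l n by auto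
  qed (use assms in auto)
  moreover have "2 * n + 3 - m = j" using assms by simp
  ultimately show ?thesis by simp
qed

text \<open>With \<open>k\<close> fixed, increasing \<open>m\<close> descends column
  \<open>k\<close> on one side and moves left along row \<open>m'\<close> on the other. The column
  recurrence and \<open>Suc_row_rec\<close> then give mirrored entries of level
  \<open>n\<close>.\<close>

lemma Suc_lower_sym:
  assumes "1 \<le> k" "k < m" "m + k' = 2 * n + 3" "k + m' = 2 * n + 3"
  shows "f (Suc n) m k = f (Suc n) m' k'"
proof (cases "m \<le> 2 * n + 2")
  case False
  then have "k' = 0" using assms by simp
  with False show ?thesis using zero_outside[of "Suc n"] by auto
next
  case True
  have "f (Suc n) m k = f (Suc n) m' (2 * n + 3 - m)"
  proof (rule second_difference_unique_down[where a = "k + 1" and b = "2 * n + 2" and m = m])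
    show "f (Suc n) (2 * n + 2) k = f (Suc n) m' (2 * n + 3 - (2 * n + 2))"
      using last_row[of k n] Suc_column_1[of m' k] assms True by simp
  next
    assume *: "k + 1 < 2 * n + 2"
    have [simp]: "2 * n + 3 - (2 * n + 2 - 1) = 2" "2 * n + 2 - 1 = 2 * n + 1" by auto
    show "f (Suc n) (2 * n + 2 - 1) k = f (Suc n) m' (2 * n + 3 - (2 * n + 2 - 1))"
      using Suc_penultimate_row[of k "m' - 2"] Suc_column_2[of m' k] assms * by simp
  next
    fix m assume m: "k + 1 \<le> m" "m + 2 \<le> 2 * n + 2"
    define i where "i = 2 * n + 1 - m"
    define l where "l = m' - 2"
    have i: "m + i = 2 * n + 1" "1 \<le> i" "2 * n + 3 - (m + 2) = i"
      "2 * n + 3 - (m + 1) = i + 1" "2 * n + 3 - m = i + 2"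
      using m by (auto simp: i_def)
    have l: "m' = l + 2" "i < l" "l \<le> 2 * n" "k + l = 2 * n + 1"
      using m assms by (auto simp: l_def i_def)
    have "f (Suc n) (m + 2) k - 2 * f (Suc n) (m + 1) k + f (Suc n) m k = - 2 * f n m k"
      using step(2)[of n k m] m n assms by simp
    moreover have "f (Suc n) m' i - 2 * f (Suc n) m' (i + 1) + f (Suc n) m' (i + 2)
        = - 2 * f n l i"
      unfolding l(1) using Suc_row_rec[of i l] i l by blast
    moreover have "f n m k = f n l i" using lower_sym[of k m i l] m i l assms by simp
    ultimately show "f (Suc n) (m + 2) k - 2 * f (Suc n) (m + 1) k + f (Suc n) m k
      = f (Suc n) m' (2 * n + 3 - (m + 2)) - 2 * f (Suc n) m' (2 * n + 3 - (m + 1))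
        + f (Suc n) m' (2 * n + 3 - m)"
      unfolding i(3-5) by simp
  qed (use assms True in auto)
  moreover have "2 * n + 3 - m = k'" using assms by simp
  ultimately show ?thesis by simp
qed

section \<open>Row sums at level \<open>Suc n\<close>\<close>

text \<open>The entry \<open>r n (2 * n + 2 - d) = r n d\<close> of column 1 is exactly the
  correction that transposition removes.\<close>

lemma Suc_row_1: "f (Suc n) 1 k = 0"
proof -
  consider "k = 1" | "2 \<le> k" "k \<le> 2 * n + 2" | "k = 0 \<or> k > 2 * n + 2" by linarith
  then show ?thesis
  proof cases
    case 1 then show ?thesis using diagonal by simp
  next
    case 2
    define d where "d = k - 1"
    have "k = 1 + d" "1 \<le> d" using 2 by (auto simp: d_def)
    with 2 show ?thesis
      using Suc_transpose[of 1 d] Suc_column_1[of "1 + d" "2 * n + 2 - d"]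
        row_sum_sym[of d "2 * n + 2 - d"] by auto
  next
    case 3 then show ?thesis using zero_outside[of "Suc n"] by auto
  qed
qed

lemma Suc_row_sum_1: "r (Suc n) 1 = 0"
  by (simp add: r_def row_sum_def Suc_row_1[unfolded One_nat_def])

text \<open>The column and row recurrences at \<open>(m + 1, m)\<close> share a right-hand side;
  their difference says that the expression is the same at \<open>m\<close> and
  \<open>m + 1\<close>. Its value is read off the last two rows.\<close>

lemma Suc_near_diagonal:
  assumes "1 \<le> m" "m \<le> 2 * n"
  shows "2 * f (Suc n) (m + 2) m - f (Suc n) (m + 1) m - f (Suc n) (m + 2) (m + 1) = r n 2"
  using assms(2,1)
proof (induction rule: inc_induct)
  case base
  then show ?case
    using last_row[of "2 * n" n] last_row[of "2 * n + 1" n] Suc_penultimate_row[of "2 * n" 1]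
      row_sum_1 row_sum_sym[of 2 "2 * n"] r_outside[of n "2 * n + 1"] n by simp
next
  case (step m)
  then show ?case
    using delta.step(2)[OF delta_axioms, of n m "m + 1"] Suc_row_rec[of m "m + 1"] n
    by (simp add: numeral_eq_Suc)
qed

text \<open>Transposes the reflected recurrence of row \<open>k + 2\<close>: the corrections form
  the second difference of \<open>r n\<close> at \<open>d\<close>, which cancels the correction
  \<open>r (n - 1) d\<close> at level \<open>n\<close>.\<close>

lemma Suc_upper_rec:
  assumes "1 \<le> m" "m < k" "k \<le> 2 * n"
  shows "f (Suc n) (m + 2) (k + 2) - 2 * f (Suc n) (m + 1) (k + 2) + f (Suc n) m (k + 2)
    = - 2 * f n m k"
proof -
  define d where "d = k - m"
  have d: "k = m + d" "1 \<le> d" "d < 2 * n" using assms by (auto simp: d_def)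
  show ?thesis
    using Suc_transpose[of m "d + 2"] Suc_transpose[of "m + 1" "d + 1"] Suc_transpose[of "m + 2" d]
      row_sum_rec[of d] Suc_row_rec[of m k] transpose[of m d] d assms
    by (simp add: numeral_eq_Suc)
qed

lemma Suc_row_sum_bottom: "r (Suc n) (2 * n + 2) = (\<Sum>k = 1..2 * n. r n k)"
proof -
  have "r (Suc n) (2 * n + 2) = (\<Sum>k = 1..2 * n + 2. r n k)"
    unfolding r_def[of "Suc n"] row_sum_def if_not_P[OF nat.simps(3)]
    by (intro sum.cong last_row) auto
  also have "\<dots> = (\<Sum>k = 1..2 * n. r n k)"
    using r_outside[of n "2 * n + 1"] r_outside[of n "2 * n + 2"] n by simp
  finally show ?thesis .
qed

lemma Suc_row_sum_penultimate: "r (Suc n) (2 * n + 1) = 2 * (\<Sum>k = 1..2 * n. r n k)"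
proof -
  have "r (Suc n) (2 * n + 1) = (\<Sum>k = 1..2 * n + 2. f (Suc n) (2 * n + 1) k)"
    by (simp add: r_def row_sum_def)
  also have "\<dots> = (\<Sum>k = 1..2 * n. f (Suc n) (2 * n + 1) k)"
    using diagonal[of "Suc n" "2 * n + 1"] step(4)[of n "2 * n + 1"] n by simp
  also have "\<dots> = (\<Sum>k = 1..2 * n. r n k + r n (2 * n + 1 - k))"
    by (intro sum.cong refl Suc_penultimate_row) auto
  also have "\<dots> = (\<Sum>k = 1..2 * n. r n k) + (\<Sum>k = 1..2 * n. r n (2 * n + 1 - k))"
    by (rule sum.distrib)
  finally show ?thesis by (simp only: sum_reflect_from_1)
qed

lemma Suc_row_sum_rec:
  assumes "1 \<le> j" "j < 2 * n + 2"
  shows "r (Suc n) (j + 2) - 2 * r (Suc n) (j + 1) + r (Suc n) j = - 2 * r n j"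
proof (cases "j = 2 * n + 1")
  case True
  \<comment> \<open>The index \<open>j + 2\<close> is outside the matrix, and the row sums at
    \<open>j\<close> and \<open>j + 1\<close> are in the ratio 2 to 1, so both sides vanish.\<close>
  then show ?thesis
    using Suc_row_sum_bottom Suc_row_sum_penultimate r_outside[of n j] 
      r_outside[of "Suc n" "j + 2"] n by simp
next
  case False
  with assms have j: "j \<le> 2 * n" by simp
  define D where "D k = f (Suc n) (j + 2) k - 2 * f (Suc n) (j + 1) k + f (Suc n) j k" for k
  have left: "D k = - 2 * f n j k" if "k \<in> {1..<j}" for k
    using step(2)[of n k j] that j n by (auto simp: D_def)
  have right: "D (k + 2) = - 2 * f n j k" if "k \<in> {j + 1..2 * n}" for k
    using Suc_upper_rec[of j k] that assms by (auto simp: D_def)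
  \<comment> \<open>Moving everything below the diagonal costs \<open>r n 1 = 0\<close> next to it
    and \<open>r n 2\<close> at distance two; the latter is cancelled by
    \<open>Suc_near_diagonal\<close>.\<close>
  have middle: "D j + D (j + 1) + D (j + 2) = 0"
    using Suc_near_diagonal[of j] Suc_transpose[of j 2] Suc_transpose[of j 1]
      Suc_transpose[of "j + 1" 1] row_sum_1 diagonal[of "Suc n"] assms j
    by (simp add: D_def numeral_eq_Suc)
  have "r (Suc n) (j + 2) - 2 * r (Suc n) (j + 1) + r (Suc n) j = (\<Sum>k = 1..2 * n + 2. D k)"
    by (simp add: r_def row_sum_def D_def sum.distrib sum_subtractf sum_distrib_left)
  also have "\<dots> = (\<Sum>k = 1..<j. D k) + (\<Sum>k = j + 1..2 * n. D (k + 2))"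
    unfolding sum_split_3[OF assms(1) j] using middle by simp
  also have "\<dots> = (\<Sum>k = 1..<j. - 2 * f n j k) + (\<Sum>k = j + 1..2 * n. - 2 * f n j k)"
    using left right by (intro arg_cong2[where f = "(+)"] sum.cong) auto
  also have "\<dots> = - 2 * (\<Sum>k = 1..2 * n. f n j k)"
    unfolding sum_split_1[OF assms(1) j] using diagonal n
    by (simp add: sum_distrib_left distrib_left)
  finally show ?thesis using n by (simp add: r_def row_sum_def)
qed

lemma Suc_row_sum_2: "r (Suc n) 2 = (\<Sum>k = 1..2 * n. r n k)"
proof -
  have f21: "f (Suc n) 2 1 = 0"
    using Suc_column_1[of 2 "2 * n + 1"] r_outside[of n "2 * n + 1"] n by simp
  \<comment> \<open>Column 2 contributes \<open>r n (2 * n + 1 - d) + r n d\<close>, and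
    transposition removes \<open>r n d\<close>.\<close>
  have f2: "f (Suc n) 2 (d + 2) = r n (2 * n + 1 - d)" if "d \<in> {1..2 * n}" for d
    using Suc_transpose[of 2 d] Suc_column_2[of "2 + d" "2 * n + 1 - d"] that
    by (auto simp: add.commute)
  have "r (Suc n) 2 = (\<Sum>k = 1..2 * n + 2. f (Suc n) 2 k)"
    by (simp add: r_def row_sum_def)
  also have "\<dots> = f (Suc n) 2 1 + f (Suc n) 2 2 + (\<Sum>k = 1..2 * n. f (Suc n) 2 (k + 2))"
    using sum_split_3[of 1 "2 * n" "f (Suc n) 2"]
      sum_split_1[of 1 "2 * n" "\<lambda>k. f (Suc n) 2 (k + 2)"] n by (simp add: numeral_eq_Suc)
  also have "\<dots> = (\<Sum>k = 1..2 * n. r n (2 * n + 1 - k))"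
    using f21 f2 diagonal[of "Suc n" 2] by simp
  finally show ?thesis by (simp only: sum_reflect_from_1)
qed

lemma Suc_row_sum_sym:
  assumes "i + j = 2 * n + 4"
  shows "r (Suc n) i = r (Suc n) j"
proof (cases "i = 0 \<or> j = 0")
  case True
  with assms show ?thesis using r_outside[of "Suc n"] by auto
next
  case False
  have "r (Suc n) i = r (Suc n) (2 * n + 4 - i)"
  \<comment> \<open>The recursion now starts from rows 1 and 2. The interval ends one past the
    matrix because 1 is mirrored to \<open>2 * n + 3\<close>, where \<open>r (Suc n)\<close> is
    0.\<close>
  proof (rule second_difference_unique_up[where a = 1 and b = "2 * n + 3" and m = i])
    show "r (Suc n) 1 = r (Suc n) (2 * n + 4 - 1)"
      using Suc_row_sum_1 r_outside[of "Suc n" "2 * n + 3"] by (simp add: add.commute)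
    have "2 * n + 4 - (1 + 1) = 2 * n + 2" by simp
    then show "r (Suc n) (1 + 1) = r (Suc n) (2 * n + 4 - (1 + 1))"
      using Suc_row_sum_2 Suc_row_sum_bottom by (simp only: one_add_one)
  next
    fix m assume m: "1 \<le> m" "m + 2 \<le> 2 * n + 3"
    define i where "i = 2 * n + 2 - m"
    have i: "m + i = 2 * n + 2" "1 \<le> i" "2 * n + 4 - (m + 2) = i"
      "2 * n + 4 - (m + 1) = i + 1" "2 * n + 4 - m = i + 2"
      using m by (auto simp: i_def)
    show "r (Suc n) (m + 2) - 2 * r (Suc n) (m + 1) + r (Suc n) m
      = r (Suc n) (2 * n + 4 - (m + 2)) - 2 * r (Suc n) (2 * n + 4 - (m + 1))
        + r (Suc n) (2 * n + 4 - m)"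
      unfolding i(3-5) using Suc_row_sum_rec[of m] Suc_row_sum_rec[of i] row_sum_sym[of m i] i m
      by auto
  qed (use assms False in auto)
  moreover have "2 * n + 4 - i = j" using assms by simp
  ultimately show ?thesis by simp
qed

lemma delta_step_Suc: "delta_step f (Suc n)"
proof
  fix k j assume "1 \<le> k" "1 \<le> j" "k + j + 1 = 2 * Suc n"
  then show "f (Suc n) (2 * Suc n - 1) k = r (Suc n - 1) k + r (Suc n - 1) j"
    using Suc_penultimate_row[of k j] by simp
next
  fix k m assume "1 \<le> k" "k < m" "m + 2 \<le> 2 * Suc n"
  then show "f (Suc n) (m + 2) k - 2 * f (Suc n) (m + 2) (k + 1) + f (Suc n) (m + 2) (k + 2)
      = - 2 * f (Suc n - 1) m k"
    using Suc_row_rec[of k m] by simp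
next
  fix k m k' m' assume "1 \<le> k" "k < m" "m + k' = 2 * Suc n + 1" "k + m' = 2 * Suc n + 1"
  then show "f (Suc n) m k = f (Suc n) m' k'" by (intro Suc_lower_sym) auto
next
  fix i j assume "i + j = 2 * Suc n + 2"
  then show "r (Suc n) i = r (Suc n) j" by (intro Suc_row_sum_sym) simp
qed (use Suc_row_sum_rec Suc_row_sum_1 Suc_transpose in auto)

end

section \<open>Base case and induction\<close>

context delta
begin

lemma r_1: "r 1 1 = 0" "r 1 2 = 1"
  using base' by (auto simp: r_def row_sum_def numeral_2_eq_2)

lemma delta_step_1: "delta_step f 1"
proof
  fix j :: nat assume "1 \<le> j" "j < 2 * 1"
  then have "j = 1" by simp
  \<comment> \<open>The values 0, 1, 0 of \<open>r 1\<close> have second difference -2, which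
    matches \<open>r 0 1 = 1\<close>.\<close>
  then show "r 1 (j + 2) - 2 * r 1 (j + 1) + r 1 j = - 2 * r (1 - 1) j"
    using r_1 r_outside[of 1 3] by (simp add: r_def[of 0] numeral_eq_Suc)
next
  fix i j :: nat assume ij: "i + j = 2 * 1 + 2"
  then have "i = 0 \<and> j = 4 \<or> i = 1 \<and> j = 3 \<or> i = 2 \<and> j = 2 \<or> i = 3 \<and> j = 1 \<or> i = 4 \<and> j = 0"
    by auto
  then show "r 1 i = r 1 j"
    using r_1(1) r_outside[of 1 0] r_outside[of 1 3] r_outside[of 1 4] by auto
next
  fix k d :: nat assume "1 \<le> k" "1 \<le> d" "k + d \<le> 2 * 1"
  then have "k = 1" "d = 1" by auto
  then show "f 1 (k + d) k = f 1 k (k + d) + r (1 - 1) d"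
    using base by (simp add: r_def numeral_eq_Suc)
next
  fix k m k' m' :: nat assume *: "1 \<le> k" "k < m" "m + k' = 2 * 1 + 1" "k + m' = 2 * 1 + 1"
  \<comment> \<open>The only lower entry \<open>(2, 1)\<close> is fixed by the reflection; for
    \<open>m = 3\<close> both positions are outside the matrix.\<close>
  consider "m = 2" "k = 1" "m' = 2" "k' = 1" | "m = 3" "k' = 0" using * by linarith
  then show "f 1 m k = f 1 m' k'"
    using zero_outside[of 1] by cases auto
qed (use r_1 in auto)

lemma delta_step: "1 \<le> n \<Longrightarrow> delta_step f n"
  by (induction n rule: dec_induct) (use delta_step_1 delta_step.delta_step_Suc in auto)

end

theorem theorem1p2:
  fixes f :: "nat \<Rightarrow> nat \<Rightarrow> nat \<Rightarrow> int"
  assumes "delta_sequence f"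
  shows "\<forall>n\<ge>1. \<forall>m\<in>{1..2 * n}. \<forall>k\<in>{1..2 * n}.
           f n m k = f n (2 * n + 1 - k) (2 * n + 1 - m)"
proof (intro allI impI ballI)
  fix n m k :: nat
  assume "1 \<le> n" "m \<in> {1..2 * n}" "k \<in> {1..2 * n}"
  interpret delta f by (rule delta.intro) (rule assms)
  interpret delta_step f n by (rule delta_step) fact
  show "f n m k = f n (2 * n + 1 - k) (2 * n + 1 - m)"
    using \<open>m \<in> _\<close> \<open>k \<in> _\<close> by (intro counter_sym) auto
qed

end
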